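(* Let $(\mathcal{S}_k,\{M_n(\mathcal{S}_k)^+\}_{n\in\mathbb{N}},e_k)_{k\in\mathbb{N}}$ be matrix ordered $*$-vector spaces with matrix order units and let $\phi_k:\mathcal{S}_k\to\mathcal{S}_{k+1}$ be unital completely positive maps, so that $\mathcal{S}_1\xrightarrow{\phi_1}\mathcal{S}_2\xrightarrow{\phi_2}\mathcal{S}_3\xrightarrow{\phi_3}\cdots$ is an inductive system in the category $\mathbf{MOU}$. Let $(\ddot{\mathcal{S}}_\infty,\{C_n\}_{n\in\mathbb{N}},\ddot e_\infty)$ and $\ddot\phi_{k,\infty}:\mathcal{S}_k\to\ddot{\mathcal{S}}_\infty$ be as constructed in the context. Then $(\ddot{\mathcal{S}}_\infty,\{C_n\}_{n\in\mathbb{N}},\ddot e_\infty)$ (with the maps $\ddot\phi_{k,\infty}$, $k\in\mathbb{N}$) is an inductive limit of this inductive system in $\mathbf{MOU}$.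
   Context: For a $*$-vector space $\mathcal{S}$ (complex vector space with conjugate-linear involution), $M_n(\mathcal{S})$ has the involution $(s_{i,j})^*=(s_{j,i}^* )$. A matrix ordering on $\mathcal{S}$ is a family $\{C_n\}_{n\in\mathbb{N}}$ of cones $C_n\subseteq M_n(\mathcal{S})_h$ with $C_n\cap(-C_n)=\{0\}$ and $\alpha^*C_n\alpha\subseteq C_m$ for all $\alpha\in M_{n,m}(\mathbb{C})$; one writes $M_n(\mathcal{S})^+=C_n$. A matrix order unit is $e\in C_1$ such that, for each $n$, $e^{(n)}=\mathrm{diag}(e,\dots,e)$ is an order unit for $(M_n(\mathcal{S}),C_n)$, i.e. for every $X\in M_n(\mathcal{S})_h$ there is $r>0$ with $re^{(n)}-X\in C_n$. A linear map $\phi$ is completely positive if all its entrywise amplifications $\phi^{(n)}$ are positive (preserve the cones). $\mathbf{MOU}$ has matrix ordered $*$-vector spaces with matrix order unit as objects, and unital completely positive maps as morphisms. Inductive limit in a category: for a system $(\{A_k\},\{\alpha_k:A_k\to A_{k+1}\})$, an object $A$ with morphisms $\alpha_{k,\infty}:A_k\to A$ such that $\alpha_{k+1,\infty}\circ\alpha_k=\alpha_{k,\infty}$ and, whenever $\beta_k:A_k\to B$ are morphisms with $\beta_{k+1}\circ\alpha_k=\beta_k$ for all $k$, there is a unique morphism $\mu:A\to B$ with $\mu\circ\alpha_{k,\infty}=\beta_k$ for all $k$. Construction. For $k<l$ put $\phi_{k,l}=\phi_{l-1}\circ\cdots\circ\phi_k$, and $\phi_{k,k}=\mathrm{id}$.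 $\ddot{\mathcal{S}}_\infty$ is the vector space of sequences $(x_k)_k\in\prod_k\mathcal{S}_k$ with $\phi_k(x_k)=x_{k+1}$ for all sufficiently large $k$, modulo the sequences that are eventually zero; $\ddot\phi_{k,\infty}(x)$ is the class of the sequence equal to $0$ at indices $i<k$ and to $\phi_{k,i}(x)$ at indices $i\ge k$. Then $\ddot{\mathcal{S}}_\infty=\bigcup_k\ddot\phi_{k,\infty}(\mathcal{S}_k)$ and $M_n(\ddot{\mathcal{S}}_\infty)=\bigcup_k\ddot\phi_{k,\infty}^{(n)}(M_n(\mathcal{S}_k))$. The involution is $\ddot\phi_{k,\infty}(x)^*=\ddot\phi_{k,\infty}(x^* )$, the unit is $\ddot e_\infty=\ddot\phi_{k,\infty}(e_k)$ (independent of $k$), and $C_n=\{\ddot\phi_{k,\infty}^{(n)}(X):k\in\mathbb{N},\ X\in M_n(\mathcal{S}_k),\ \exists m\ge k\text{ with }\phi_{k,m}^{(n)}(X)\in M_n(\mathcal{S}_m)^+\}$. *)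

theory Defs
  imports "Jordan_Normal_Form.Matrix" "HOL-Algebra.AbelCoset" "HOL-Library.FuncSet" Complex_Main
begin

abbreviation complex_field :: "complex ring" where
  "complex_field \<equiv> \<lparr>carrier = UNIV, monoid.mult = (*), one = 1, ring.zero = 0, add = (+)\<rparr>"

text \<open>
  A space is a complex vector space with explicit carrier, in the sense of HOL-Algebra (the
  fields \<open>mult\<close> and \<open>one\<close> that modules inherit from rings are never used), together
  with an involution, a family of sets of matrices, and a distinguished element. Only
  \<open>cone S n\<close> with \<open>n \<ge> 1\<close> is meaningful.
\<close>

record 'a mou = "(complex, 'a) module" +
  star :: "'a \<Rightarrow> 'a"
  cone :: "nat \<Rightarrow> 'a mat set"
  ounit :: 'a

section \<open>Matrices over a space\<close>

definition Mat :: "nat \<Rightarrow> ('a, 'z) mou_scheme \<Rightarrow> (complex, 'a mat) module" where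
  "Mat n S =
    \<lparr>carrier = {X \<in> carrier_mat n n. elements_mat X \<subseteq> carrier S},
     monoid.mult = undefined, one = undefined,
     ring.zero = mat n n (\<lambda>_. \<zero>\<^bsub>S\<^esub>),
     add = (\<lambda>X Y. mat n n (\<lambda>ij. X $$ ij \<oplus>\<^bsub>S\<^esub> Y $$ ij)),
     smult = (\<lambda>a X. mat n n (\<lambda>ij. a \<odot>\<^bsub>S\<^esub> X $$ ij))\<rparr>"

definition mat_star :: "('a, 'z) mou_scheme \<Rightarrow> 'a mat \<Rightarrow> 'a mat" where
  "mat_star S X = mat (dim_col X) (dim_row X) (\<lambda>(i, j). star S (X $$ (j, i)))"

definition herm :: "nat \<Rightarrow> ('a, 'z) mou_scheme \<Rightarrow> 'a mat set" where
  "herm n S = {X \<in> carrier (Mat n S). mat_star S X = X}"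

text \<open>\<open>compress S \<alpha> X\<close> is \<open>\<alpha>\<^sup>* X \<alpha>\<close>.\<close>

definition compress :: "('a, 'z) mou_scheme \<Rightarrow> complex mat \<Rightarrow> 'a mat \<Rightarrow> 'a mat" where
  "compress S \<alpha> X = mat (dim_col \<alpha>) (dim_col \<alpha>) (\<lambda>(i, j).
     \<Oplus>\<^bsub>S\<^esub>k\<in>{..<dim_row \<alpha>}. \<Oplus>\<^bsub>S\<^esub>l\<in>{..<dim_row \<alpha>}.
       (cnj (\<alpha> $$ (k, i)) * \<alpha> $$ (l, j)) \<odot>\<^bsub>S\<^esub> X $$ (k, l))"

definition diag_unit :: "nat \<Rightarrow> ('a, 'z) mou_scheme \<Rightarrow> 'a mat" where
  "diag_unit n S = mat n n (\<lambda>(i, j). if i = j then ounit S else \<zero>\<^bsub>S\<^esub>)"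


section \<open>The category MOU\<close>

locale star_vector_space = module complex_field S
  for S :: "('a, 'z) mou_scheme" (structure) +
  assumes star_closed: "x \<in> carrier S \<Longrightarrow> star S x \<in> carrier S"
    and star_star: "x \<in> carrier S \<Longrightarrow> star S (star S x) = x"
    and star_add: "\<lbrakk>x \<in> carrier S; y \<in> carrier S\<rbrakk> \<Longrightarrow> star S (x \<oplus> y) = star S x \<oplus> star S y"
    and star_smult: "x \<in> carrier S \<Longrightarrow> star S (a \<odot> x) = cnj a \<odot> star S x"

locale matrix_ordered_space = star_vector_space +
  assumes cone_herm: "n \<ge> 1 \<Longrightarrow> cone S n \<subseteq> herm n S"
    and cone_nonempty: "n \<ge> 1 \<Longrightarrow> cone S n \<noteq> {}"
    and cone_add: "\<lbrakk>n \<ge> 1; X \<in> cone S n; Y \<in> cone S n\<rbrakk> \<Longrightarrow> X \<oplus>\<^bsub>Mat n S\<^esub> Y \<in> cone S n"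
    and cone_smult: "\<lbrakk>n \<ge> 1; r \<ge> 0; X \<in> cone S n\<rbrakk> \<Longrightarrow> complex_of_real r \<odot>\<^bsub>Mat n S\<^esub> X \<in> cone S n"
    and cone_proper:
      "n \<ge> 1 \<Longrightarrow> cone S n \<inter> (\<lambda>X. \<ominus>\<^bsub>Mat n S\<^esub> X) ` cone S n = {\<zero>\<^bsub>Mat n S\<^esub>}"
    and cone_compress:
      "\<lbrakk>n \<ge> 1; m \<ge> 1; \<alpha> \<in> carrier_mat n m; X \<in> cone S n\<rbrakk> \<Longrightarrow> compress S \<alpha> X \<in> cone S m"

locale MOU_object = matrix_ordered_space +
  assumes ounit_closed: "ounit S \<in> carrier S"
    and ounit_cone: "mat 1 1 (\<lambda>_. ounit S) \<in> cone S 1"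
    and order_unit: "\<lbrakk>n \<ge> 1; X \<in> herm n S\<rbrakk> \<Longrightarrow>
      \<exists>r>0. complex_of_real r \<odot>\<^bsub>Mat n S\<^esub> diag_unit n S \<ominus>\<^bsub>Mat n S\<^esub> X \<in> cone S n"

definition linear_on :: "('a, 'z) mou_scheme \<Rightarrow> ('b, 'y) mou_scheme \<Rightarrow> ('a \<Rightarrow> 'b) \<Rightarrow> bool" where
  "linear_on S T f \<longleftrightarrow> f \<in> carrier S \<rightarrow> carrier T \<and>
     (\<forall>x\<in>carrier S. \<forall>y\<in>carrier S. f (x \<oplus>\<^bsub>S\<^esub> y) = f x \<oplus>\<^bsub>T\<^esub> f y) \<and>
     (\<forall>a. \<forall>x\<in>carrier S. f (a \<odot>\<^bsub>S\<^esub> x) = a \<odot>\<^bsub>T\<^esub> f x)"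

definition completely_positive ::
    "('a, 'z) mou_scheme \<Rightarrow> ('b, 'y) mou_scheme \<Rightarrow> ('a \<Rightarrow> 'b) \<Rightarrow> bool" where
  "completely_positive S T f \<longleftrightarrow> (\<forall>n\<ge>1. \<forall>X\<in>cone S n. map_mat f X \<in> cone T n)"

text \<open>As for \<^const>\<open>hom\<close>, the values of a morphism outside the carrier are irrelevant.\<close>

definition MOU_hom :: "('a, 'z) mou_scheme \<Rightarrow> ('b, 'y) mou_scheme \<Rightarrow> ('a \<Rightarrow> 'b) set" where
  "MOU_hom S T = {f. linear_on S T f \<and> completely_positive S T f \<and> f (ounit S) = ounit T}"

text \<open>
  The members of the system have their carriers in a common type, which loses no generality (pass to
  a disjoint union), and they are indexed from \<open>0\<close>.
\<close>

definition MOU_system :: "(nat \<Rightarrow> 'a mou) \<Rightarrow> (nat \<Rightarrow> 'a \<Rightarrow> 'a) \<Rightarrow> bool" where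
  "MOU_system S \<phi> \<longleftrightarrow> (\<forall>k. MOU_object (S k)) \<and> (\<forall>k. \<phi> k \<in> MOU_hom (S k) (S (Suc k)))"

definition MOU_cocone ::
    "(nat \<Rightarrow> 'a mou) \<Rightarrow> (nat \<Rightarrow> 'a \<Rightarrow> 'a) \<Rightarrow> 'b mou \<Rightarrow> (nat \<Rightarrow> 'a \<Rightarrow> 'b) \<Rightarrow> bool" where
  "MOU_cocone S \<phi> B \<beta> \<longleftrightarrow> MOU_object B \<and> (\<forall>k. \<beta> k \<in> MOU_hom (S k) B) \<and>
     (\<forall>k. \<forall>x\<in>carrier (S k). \<beta> (Suc k) (\<phi> k x) = \<beta> k x)"

text \<open>
  The universal property, tested against objects with carrier in type \<open>'b\<close>; an inductive limit
  satisfies this for every type \<open>'b\<close>. The extensionality condition makes uniqueness of \<open>\<mu>\<close> mean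
  uniqueness on the carrier of \<open>A\<close>.
\<close>

definition MOU_inductive_limit ::
    "'b itself \<Rightarrow> (nat \<Rightarrow> 'a mou) \<Rightarrow> (nat \<Rightarrow> 'a \<Rightarrow> 'a) \<Rightarrow> 'c mou \<Rightarrow> (nat \<Rightarrow> 'a \<Rightarrow> 'c) \<Rightarrow> bool" where
  "MOU_inductive_limit _ S \<phi> A \<alpha> \<longleftrightarrow> MOU_cocone S \<phi> A \<alpha> \<and>
     (\<forall>(B :: 'b mou) \<beta>. MOU_cocone S \<phi> B \<beta> \<longrightarrow>
       (\<exists>!\<mu>. \<mu> \<in> extensional (carrier A) \<and> \<mu> \<in> MOU_hom A B \<and>
             (\<forall>k. \<forall>x\<in>carrier (S k). \<mu> (\<alpha> k x) = \<beta> k x)))"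


section \<open>The construction\<close>

text \<open>\<open>connect \<phi> k l = \<phi> (l - 1) \<circ> \<dots> \<circ> \<phi> k\<close>, the identity for \<open>k = l\<close>.\<close>

definition connect :: "(nat \<Rightarrow> 'a \<Rightarrow> 'a) \<Rightarrow> nat \<Rightarrow> nat \<Rightarrow> 'a \<Rightarrow> 'a" where
  "connect \<phi> k l = fold \<phi> [k..<l]"

definition seq_space ::
    "(nat \<Rightarrow> 'a mou) \<Rightarrow> (nat \<Rightarrow> 'a \<Rightarrow> 'a) \<Rightarrow> (complex, nat \<Rightarrow> 'a) module" where
  "seq_space S \<phi> =
    \<lparr>carrier = {x. (\<forall>k. x k \<in> carrier (S k)) \<and> (\<forall>\<^sub>F k in sequentially. \<phi> k (x k) = x (Suc k))},
     monoid.mult = undefined, one = undefined,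
     ring.zero = (\<lambda>k. \<zero>\<^bsub>S k\<^esub>),
     add = (\<lambda>x y k. x k \<oplus>\<^bsub>S k\<^esub> y k),
     smult = (\<lambda>a x k. a \<odot>\<^bsub>S k\<^esub> x k)\<rparr>"

definition null_seqs :: "(nat \<Rightarrow> 'a mou) \<Rightarrow> (nat \<Rightarrow> 'a \<Rightarrow> 'a) \<Rightarrow> (nat \<Rightarrow> 'a) set" where
  "null_seqs S \<phi> = {x \<in> carrier (seq_space S \<phi>). \<forall>\<^sub>F k in sequentially. x k = \<zero>\<^bsub>S k\<^esub>}"

definition lim_map ::
    "(nat \<Rightarrow> 'a mou) \<Rightarrow> (nat \<Rightarrow> 'a \<Rightarrow> 'a) \<Rightarrow> nat \<Rightarrow> 'a \<Rightarrow> (nat \<Rightarrow> 'a) set" where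
  "lim_map S \<phi> k x =
     null_seqs S \<phi> +>\<^bsub>seq_space S \<phi>\<^esub> (\<lambda>i. if i < k then \<zero>\<^bsub>S i\<^esub> else connect \<phi> k i x)"

text \<open>
  The vector space structure is that of the quotient of \<^const>\<open>seq_space\<close> by \<^const>\<open>null_seqs\<close>;
  the scalar multiple of a coset is written like the product of cosets in
  \<open>rcoset_mult\<close>. The involution is the one determined by
  \<open>(lim_map S \<phi> k x)\<^sup>* = lim_map S \<phi> k (x\<^sup>*)\<close>. The unit is \<open>lim_map S \<phi> k (ounit (S k))\<close> for
  any \<open>k\<close>; here \<open>k = 0\<close>.
\<close>

definition lim_space ::
    "(nat \<Rightarrow> 'a mou) \<Rightarrow> (nat \<Rightarrow> 'a \<Rightarrow> 'a) \<Rightarrow> (nat \<Rightarrow> 'a) set mou" where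
  "lim_space S \<phi> =
    \<lparr>carrier = a_rcosets\<^bsub>seq_space S \<phi>\<^esub> (null_seqs S \<phi>),
     monoid.mult = undefined, one = undefined,
     ring.zero = null_seqs S \<phi>,
     add = set_add (seq_space S \<phi>),
     smult = (\<lambda>a c. \<Union>x\<in>c. null_seqs S \<phi> +>\<^bsub>seq_space S \<phi>\<^esub> (a \<odot>\<^bsub>seq_space S \<phi>\<^esub> x)),
     star = (\<lambda>c. THE d. \<exists>k. \<exists>x\<in>carrier (S k).
               c = lim_map S \<phi> k x \<and> d = lim_map S \<phi> k (star (S k) x)),
     cone = (\<lambda>n. {map_mat (lim_map S \<phi> k) X | k X.
               X \<in> carrier (Mat n (S k)) \<and>
               (\<exists>m\<ge>k. map_mat (connect \<phi> k m) X \<in> cone (S m) n)}),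
     ounit = lim_map S \<phi> 0 (ounit (S 0))\<rparr>"

end

theory Submission
  imports Defs
begin

text \<open>
  Any finite set of elements of the limit, in particular the entries of a matrix, comes from a single
  \<open>S k\<close>, and an equation between images from \<open>S k\<close> already holds in some \<open>S m\<close>. So every axiom for the
  limit is pulled back to one of the \<open>S m\<close>; for properness of the cones, \<open>X\<close> and \<open>- X\<close> are represented
  by positive matrices whose sum vanishes at a later stage. The involution descends to the limit
  because unital completely positive maps preserve it, and the induced map out of the limit is the
  common value of the maps of the cocone.
\<close>

section \<open>Matrices over a complex vector space\<close>

text \<open>Vector space structure without an involution: the limit enters here first, and its
  involution is treated only afterwards.\<close>

locale complex_space = module complex_field S for S :: "('a, 'z) mou_scheme" (structure)
begin

text \<open>The \<open>module\<close> facts mention the record \<open>complex_field\<close>;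
  simplification replaces its carrier and operations by \<open>UNIV\<close> and ordinary
  arithmetic.\<close>

lemmas complex_smult_rules [simp] =
  smult_closed [simplified] smult_r_null [simplified] smult_one [simplified]

lemma diff_eq_zero_iff: "x \<in> carrier S \<Longrightarrow> y \<in> carrier S \<Longrightarrow> x \<ominus> y = \<zero> \<longleftrightarrow> x = y"
  by (metis M.add.inv_closed M.minus_equality M.minus_minus M.r_neg a_minus_def)

lemma complex_smult_minus: "x \<in> carrier S \<Longrightarrow> (- a) \<odot> x = \<ominus> (a \<odot> x)"
  using smult_l_distr [of "- a" a x] smult_l_null [of x]
  by (simp add: M.minus_equality)

end

sublocale star_vector_space \<subseteq> complex_space ..

lemma carrier_Mat_iff:
  "X \<in> carrier (Mat n S) \<longleftrightarrow>
    X \<in> carrier_mat n n \<and> (\<forall>i<n. \<forall>j<n. X $$ (i, j) \<in> carrier S)"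
  unfolding Mat_def by (auto dest!: elements_matD)

lemma Mat_simps [simp]:
  "\<zero>\<^bsub>Mat n S\<^esub> = mat n n (\<lambda>_. \<zero>\<^bsub>S\<^esub>)"
  "X \<oplus>\<^bsub>Mat n S\<^esub> Y = mat n n (\<lambda>ij. X $$ ij \<oplus>\<^bsub>S\<^esub> Y $$ ij)"
  "a \<odot>\<^bsub>Mat n S\<^esub> X = mat n n (\<lambda>ij. a \<odot>\<^bsub>S\<^esub> X $$ ij)"
  by (simp_all add: Mat_def)

lemma mat_in_carrier_Mat [simp]:
  "mat n n f \<in> carrier (Mat n S) \<longleftrightarrow> (\<forall>i<n. \<forall>j<n. f (i, j) \<in> carrier S)"
  by (simp add: carrier_Mat_iff)

context complex_space
begin

lemma abelian_group_Mat: "abelian_group (Mat n S)"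
proof (rule abelian_groupI, goal_cases)
  \<comment> \<open>Case 6 of \<open>abelian_groupI\<close> is the existence of inverses.\<close>
  case (6 X)
  then show ?case
    by (intro bexI [of _ "mat n n (\<lambda>ij. \<ominus> X $$ ij)"])
      (auto simp: carrier_Mat_iff M.l_neg intro: eq_matI)
qed (auto simp: carrier_Mat_iff M.a_ac)

text \<open>Negation is not a field of the record but the inverse in the additive group, so its
  entrywise form comes from uniqueness of inverses.\<close>

lemma Mat_minus:
  assumes "X \<in> carrier (Mat n S)"
  shows "\<ominus>\<^bsub>Mat n S\<^esub> X = mat n n (\<lambda>ij. \<ominus> X $$ ij)"
proof -
  interpret Mn: abelian_group "Mat n S" by (rule abelian_group_Mat)
  show ?thesis
    using assms
    by (intro Mn.minus_equality) (auto simp: carrier_Mat_iff M.l_neg intro: eq_matI)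
qed

lemma Mat_diff:
  assumes "X \<in> carrier (Mat n S)" "Y \<in> carrier (Mat n S)"
  shows "X \<ominus>\<^bsub>Mat n S\<^esub> Y = mat n n (\<lambda>ij. X $$ ij \<ominus> Y $$ ij)"
  using assms by (auto simp: a_minus_def Mat_minus intro: eq_matI)

end

section \<open>Involution and positive cones of a single space\<close>

lemma mat_star_carrier:
  "X \<in> carrier (Mat n S) \<Longrightarrow> mat_star S X = mat n n (\<lambda>(i, j). star S (X $$ (j, i)))"
  by (auto simp: mat_star_def carrier_Mat_iff)

lemma herm_iff:
  "X \<in> herm n S \<longleftrightarrow> X \<in> carrier (Mat n S) \<and>
    (\<forall>i<n. \<forall>j<n. star S (X $$ (j, i)) = X $$ (i, j))"
  by (auto simp: herm_def mat_star_carrier mat_eq_iff carrier_Mat_iff)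

lemma (in star_vector_space) star_zero: "star S \<zero> = \<zero>"
  using star_add [of \<zero> \<zero>] star_closed [of \<zero>]
  by (metis M.add.r_cancel_one M.zero_closed M.l_zero)

lemma (in star_vector_space) star_minus: "x \<in> carrier S \<Longrightarrow> star S (\<ominus> x) = \<ominus> star S x"
  by (metis M.add.inv_closed M.l_neg M.minus_equality star_add star_closed star_zero)

lemma (in star_vector_space) cartesian_decomposition:
  assumes x: "x \<in> carrier S"
  obtains a b where "a \<in> carrier S" "star S a = a" "b \<in> carrier S" "star S b = b"
    "x = a \<oplus> \<i> \<odot> b"
proof
  let ?a = "(1/2) \<odot> (x \<oplus> star S x)" and ?b = "(- \<i>/2) \<odot> (x \<ominus> star S x)"
  note sx = star_closed [OF x]
  show "?a \<in> carrier S" "?b \<in> carrier S" "star S ?a = ?a"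
    using x sx by (simp_all add: star_add star_smult star_star M.a_comm)
  \<comment> \<open>The involution conjugates the coefficient and reverses the difference; the two
    changes of sign cancel.\<close>
  have "star S ?b = (\<i>/2) \<odot> (\<ominus> (x \<ominus> star S x))"
    using x sx by (simp add: star_smult a_minus_def star_add star_minus star_star M.minus_add M.a_comm)
  also have "\<dots> = ?b"
    using x sx complex_smult_minus [of "x \<ominus> star S x" "\<i>/2"]
      smult_r_minus [of "\<i>/2" "x \<ominus> star S x"] by simp
  finally show "star S ?b = ?b" .
  let ?y = "(1/2) \<odot> x" and ?z = "(1/2) \<odot> star S x"
  have "\<i> \<odot> ?b = (1/2) \<odot> (x \<ominus> star S x)"
    using smult_assoc1 [of \<i> "- \<i>/2" "x \<ominus> star S x"] x sx by simp
  also have "\<dots> = ?y \<ominus> ?z"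
    using x sx smult_r_minus [of "1/2" "star S x"]
    by (simp add: a_minus_def smult_r_distr [simplified])
  finally have "?a \<oplus> \<i> \<odot> ?b = (?y \<oplus> ?z) \<oplus> (?y \<oplus> \<ominus> ?z)"
    using x sx by (simp add: a_minus_def smult_r_distr [simplified])
  also have "\<dots> = (?y \<oplus> ?y) \<oplus> (?z \<oplus> \<ominus> ?z)"
    using x sx by (simp add: M.a_ac)
  also have "\<dots> = x"
    using smult_l_distr [of "1/2" "1/2" x] x sx by (simp add: M.r_neg)
  finally show "x = ?a \<oplus> \<i> \<odot> ?b" by simp
qed

lemma (in matrix_ordered_space) cone_carrier: "n \<ge> 1 \<Longrightarrow> X \<in> cone S n \<Longrightarrow> X \<in> carrier (Mat n S)"
  using cone_herm by (auto simp: herm_def)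

text \<open>Properness is an equality of sets, so it also says that zero is positive.\<close>

lemma (in matrix_ordered_space) zero_in_cone: "n \<ge> 1 \<Longrightarrow> mat n n (\<lambda>_. \<zero>) \<in> cone S n"
  using cone_proper [of n] by auto

text \<open>Properness in a form suited to transport along linear maps: it speaks of a vanishing
  sum, so only addition and zero have to be carried over.\<close>

lemma (in matrix_ordered_space) cone_antisym:
  assumes "n \<ge> 1" "X \<in> cone S n" "Y \<in> cone S n" "X \<oplus>\<^bsub>Mat n S\<^esub> Y = \<zero>\<^bsub>Mat n S\<^esub>"
  shows "X = \<zero>\<^bsub>Mat n S\<^esub>"
proof -
  interpret Mn: abelian_group "Mat n S" by (rule abelian_group_Mat)
  have "\<ominus>\<^bsub>Mat n S\<^esub> Y = X"
    using assms cone_carrier by (metis Mn.minus_equality)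
  then have "X \<in> cone S n \<inter> (\<lambda>X. \<ominus>\<^bsub>Mat n S\<^esub> X) ` cone S n"
    using assms by blast
  then show ?thesis
    using cone_proper [OF assms(1)] by blast
qed

section \<open>Linear maps and their amplifications\<close>

text \<open>Linearity alone, so that the connecting maps, the maps into the limit and the members of
  a cocone are all instances.\<close>

locale complex_linear = S: complex_space S + T: complex_space T
  for S :: "('a, 'z) mou_scheme" and T :: "('b, 'y) mou_scheme" +
  fixes f
  assumes linear: "linear_on S T f"
begin

lemma closed [simp]: "x \<in> carrier S \<Longrightarrow> f x \<in> carrier T"
  and add: "x \<in> carrier S \<Longrightarrow> y \<in> carrier S \<Longrightarrow> f (x \<oplus>\<^bsub>S\<^esub> y) = f x \<oplus>\<^bsub>T\<^esub> f y"
  and smult: "x \<in> carrier S \<Longrightarrow> f (a \<odot>\<^bsub>S\<^esub> x) = a \<odot>\<^bsub>T\<^esub> f x"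
  using linear by (auto simp: linear_on_def)

sublocale abelian_group_hom S T f
proof (intro abelian_group_hom.intro abelian_group_hom_axioms.intro group_hom.intro
    group_hom_axioms.intro)
  show "f \<in> hom (add_monoid S) (add_monoid T)"
    by (auto simp: hom_def add)
qed (rule S.abelian_group_axioms T.abelian_group_axioms S.a_group T.a_group)+

lemma zero: "f \<zero>\<^bsub>S\<^esub> = \<zero>\<^bsub>T\<^esub>"
  by (rule hom_zero)

text \<open>For infinite \<open>A\<close> both sums have the default value zero, which
  \<open>f\<close> preserves.\<close>

lemma hom_finsum: "g \<in> A \<rightarrow> carrier S \<Longrightarrow> f (finsum S g A) = finsum T (\<lambda>i. f (g i)) A"
  by (induct A rule: infinite_finite_induct) (auto simp: Pi_def)

lemma map_mat_carrier: "X \<in> carrier (Mat n S) \<Longrightarrow> map_mat f X \<in> carrier (Mat n T)"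
  by (auto simp: carrier_Mat_iff)

lemma map_mat_add:
  "\<lbrakk>X \<in> carrier (Mat n S); Y \<in> carrier (Mat n S)\<rbrakk>
    \<Longrightarrow> map_mat f (X \<oplus>\<^bsub>Mat n S\<^esub> Y) = map_mat f X \<oplus>\<^bsub>Mat n T\<^esub> map_mat f Y"
  by (auto simp: carrier_Mat_iff intro: eq_matI)

lemma map_mat_smult:
  "X \<in> carrier (Mat n S) \<Longrightarrow> map_mat f (a \<odot>\<^bsub>Mat n S\<^esub> X) = a \<odot>\<^bsub>Mat n T\<^esub> map_mat f X"
  by (auto simp: carrier_Mat_iff smult intro: eq_matI)

lemma map_mat_zero: "map_mat f \<zero>\<^bsub>Mat n S\<^esub> = \<zero>\<^bsub>Mat n T\<^esub>"
  by (auto)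

lemma map_mat_diff:
  "\<lbrakk>X \<in> carrier (Mat n S); Y \<in> carrier (Mat n S)\<rbrakk>
    \<Longrightarrow> map_mat f (X \<ominus>\<^bsub>Mat n S\<^esub> Y) = map_mat f X \<ominus>\<^bsub>Mat n T\<^esub> map_mat f Y"
  by (auto simp: S.Mat_diff T.Mat_diff map_mat_carrier)
    (auto simp: carrier_Mat_iff a_minus_def intro: eq_matI)

text \<open>Each entry of \<open>compress S \<alpha> X\<close> is a linear combination of entries of
  \<open>X\<close>, with coefficients that depend on \<open>\<alpha>\<close> alone.\<close>

lemma map_mat_compress:
  assumes "\<alpha> \<in> carrier_mat n m" "X \<in> carrier (Mat n S)"
  shows "map_mat f (compress S \<alpha> X) = compress T \<alpha> (map_mat f X)"
  using assms
  by (auto simp: compress_def carrier_Mat_iff hom_finsum smult Pi_def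
      intro!: eq_matI T.finsum_cong' S.finsum_closed)

lemma map_mat_diag_unit:
  "f (ounit S) = ounit T \<Longrightarrow> map_mat f (diag_unit n S) = diag_unit n T"
  by (auto simp: diag_unit_def intro: eq_matI)

end

lemma MOU_hom_comp:
  assumes "f \<in> MOU_hom S T" "g \<in> MOU_hom T U"
  shows "g \<circ> f \<in> MOU_hom S U"
proof -
  have "map_mat (g \<circ> f) X = map_mat g (map_mat f X)" for X
    by (auto)
  with assms show ?thesis
    by (auto simp: MOU_hom_def linear_on_def completely_positive_def Pi_iff)
qed

lemma MOU_hom_id:
  assumes "complex_space S"
  shows "id \<in> MOU_hom S S"
proof -
  have "map_mat id X = X" for X :: "'a mat"
    by (auto)
  then show ?thesis
    by (auto simp: MOU_hom_def linear_on_def completely_positive_def)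
qed

text \<open>A Hermitian element is a difference of two positive ones, so positive maps preserve
  Hermitian elements.\<close>

lemma MOU_hom_star:
  assumes "MOU_object S" "MOU_object T" and f: "f \<in> MOU_hom S T" and x: "x \<in> carrier S"
  shows "f (star S x) = star T (f x)"
proof -
  interpret S: MOU_object S by fact
  interpret T: MOU_object T by fact
  interpret complex_linear S T f
    using f by unfold_locales (auto simp: MOU_hom_def)
  have star_cone: "star T y = y" if "mat 1 1 (\<lambda>_. y) \<in> cone T 1" for y
    using T.cone_herm [of 1] that by (auto simp: herm_iff)
  have unit: "star T (f (ounit S)) = f (ounit S)"
    using f T.ounit_cone star_cone by (auto simp: MOU_hom_def)
  have herm: "star T (f h) = f h" if h: "h \<in> carrier S" "star S h = h" for h
  proof -
    \<comment> \<open>The element \<open>h\<close> is the difference of \<open>re r\<close> and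
      \<open>re r - h\<close>; for the \<open>r\<close> supplied by the order unit property the
      latter is positive.\<close>
    define re where "re r = complex_of_real r \<odot>\<^bsub>S\<^esub> ounit S" for r
    have re: "re r \<in> carrier S" for r
      by (simp add: re_def S.ounit_closed)
    have "mat 1 1 (\<lambda>_. h) \<in> herm 1 S"
      using h by (auto simp: herm_iff)
    then obtain r where
      r: "complex_of_real r \<odot>\<^bsub>Mat 1 S\<^esub> diag_unit 1 S \<ominus>\<^bsub>Mat 1 S\<^esub> mat 1 1 (\<lambda>_. h) \<in> cone S 1"
      using S.order_unit [of 1] by blast
    also have "complex_of_real r \<odot>\<^bsub>Mat 1 S\<^esub> diag_unit 1 S \<ominus>\<^bsub>Mat 1 S\<^esub> mat 1 1 (\<lambda>_. h)
        = mat 1 1 (\<lambda>_. re r \<ominus>\<^bsub>S\<^esub> h)"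
      using h S.ounit_closed
      by (subst S.Mat_diff) (auto simp: diag_unit_def re_def intro: eq_matI)
    finally have "map_mat f (mat 1 1 (\<lambda>_. re r \<ominus>\<^bsub>S\<^esub> h)) \<in> cone T 1"
      using f by (auto simp: MOU_hom_def completely_positive_def)
    also have "map_mat f (mat 1 1 (\<lambda>_. re r \<ominus>\<^bsub>S\<^esub> h)) = mat 1 1 (\<lambda>_. f (re r \<ominus>\<^bsub>S\<^esub> h))"
      by (auto)
    finally have "star T (f (re r \<ominus>\<^bsub>S\<^esub> h)) = f (re r \<ominus>\<^bsub>S\<^esub> h)"
      by (rule star_cone)
    moreover have "star T (f (re r)) = f (re r)"
      using unit S.ounit_closed by (simp add: re_def smult T.star_smult)
    moreover have "f h = f (re r) \<ominus>\<^bsub>T\<^esub> f (re r \<ominus>\<^bsub>S\<^esub> h)"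
      using h re [of r] by (simp add: a_minus_def T.M.minus_add T.M.a_assoc [symmetric] T.M.r_neg)
    ultimately show ?thesis
      using h re [of r]
      by (metis S.M.minus_closed T.M.add.inv_closed T.star_add T.star_minus a_minus_def closed)
  qed
  obtain a b where ab: "a \<in> carrier S" "star S a = a" "b \<in> carrier S" "star S b = b"
    and x_eq: "x = a \<oplus>\<^bsub>S\<^esub> \<i> \<odot>\<^bsub>S\<^esub> b"
    using S.cartesian_decomposition [OF x] by blast
  \<comment> \<open>Hermitian parts are fixed and \<open>\<i>\<close> becomes \<open>- \<i>\<close>;
    the same computation in \<open>T\<close>, applied to the images of \<open>a\<close> and
    \<open>b\<close>, gives \<open>star T (f x)\<close>.\<close>
  have "star S x = a \<oplus>\<^bsub>S\<^esub> (- \<i>) \<odot>\<^bsub>S\<^esub> b"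
    using ab by (simp add: x_eq S.star_add S.star_smult)
  then show ?thesis
    using ab herm by (simp add: x_eq add smult T.star_add T.star_smult)
qed


section \<open>The limit space\<close>

locale MOU_inductive_system =
  fixes S :: "nat \<Rightarrow> 'a mou" and \<phi> :: "nat \<Rightarrow> 'a \<Rightarrow> 'a"
  assumes system: "MOU_system S \<phi>"
begin

sublocale S: MOU_object "S k" for k
  using system by (simp add: MOU_system_def)

lemma \<phi>_hom: "\<phi> k \<in> MOU_hom (S k) (S (Suc k))"
  using system by (simp add: MOU_system_def)

sublocale \<phi>: complex_linear "S k" "S (Suc k)" "\<phi> k" for k
  using \<phi>_hom by unfold_locales (auto simp: MOU_hom_def)

abbreviation "seqs \<equiv> seq_space S \<phi>"
abbreviation "nulls \<equiv> null_seqs S \<phi>"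
abbreviation "L \<equiv> lim_space S \<phi>"
abbreviation "\<iota> \<equiv> lim_map S \<phi>"
abbreviation "con \<equiv> connect \<phi>"

section \<open>Connecting maps between the stages\<close>

lemma connect_self [simp]: "con k k = id"
  by (simp add: connect_def)

lemma connect_Suc: "k \<le> l \<Longrightarrow> con k (Suc l) x = \<phi> l (con k l x)"
  by (simp add: connect_def)

lemma connect_connect: "l \<le> m \<Longrightarrow> k \<le> l \<Longrightarrow> con l m (con k l x) = con k m x"
  by (induction rule: dec_induct) (auto simp: connect_Suc)

lemma connect_hom: "k \<le> l \<Longrightarrow> con k l \<in> MOU_hom (S k) (S l)"
proof (induction l rule: dec_induct)
  case base
  show ?case unfolding connect_self by (rule MOU_hom_id [OF S.complex_space_axioms])
next
  case (step l)
  then have "con k (Suc l) = \<phi> l \<circ> con k l"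
    by (auto simp: connect_Suc)
  then show ?case using MOU_hom_comp [OF step.IH \<phi>_hom] by (simp only:)
qed

lemma connect_linear: "k \<le> l \<Longrightarrow> complex_linear (S k) (S l) (con k l)"
  using connect_hom by unfold_locales (auto simp: MOU_hom_def)

lemma connect_star: "k \<le> l \<Longrightarrow> x \<in> carrier (S k) \<Longrightarrow> con k l (star (S k) x) = star (S l) (con k l x)"
  by (rule MOU_hom_star [OF S.MOU_object_axioms S.MOU_object_axioms connect_hom])

lemma connect_cone: "k \<le> l \<Longrightarrow> n \<ge> 1 \<Longrightarrow> X \<in> cone (S k) n \<Longrightarrow> map_mat (con k l) X \<in> cone (S l) n"
  using connect_hom by (auto simp: MOU_hom_def completely_positive_def)

lemma connect_ounit: "k \<le> l \<Longrightarrow> con k l (ounit (S k)) = ounit (S l)"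
  using connect_hom by (auto simp: MOU_hom_def)

lemma connect_closed [simp]: "k \<le> l \<Longrightarrow> x \<in> carrier (S k) \<Longrightarrow> con k l x \<in> carrier (S l)"
  by (rule complex_linear.closed [OF connect_linear])

section \<open>Eventually compatible sequences and their quotient by the null sequences\<close>

lemma seqs_simps [simp]:
  "\<zero>\<^bsub>seqs\<^esub> = (\<lambda>k. \<zero>\<^bsub>S k\<^esub>)"
  "x \<oplus>\<^bsub>seqs\<^esub> y = (\<lambda>k. x k \<oplus>\<^bsub>S k\<^esub> y k)"
  "a \<odot>\<^bsub>seqs\<^esub> x = (\<lambda>k. a \<odot>\<^bsub>S k\<^esub> x k)"
  by (simp_all add: seq_space_def)

lemma carrier_seqs_iff:
  "x \<in> carrier seqs \<longleftrightarrow>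
    (\<forall>k. x k \<in> carrier (S k)) \<and> (\<forall>\<^sub>F k in sequentially. \<phi> k (x k) = x (Suc k))"
  by (simp add: seq_space_def)

lemma seqs_coord: "x \<in> carrier seqs \<Longrightarrow> x k \<in> carrier (S k)"
  by (simp add: carrier_seqs_iff)

lemma seqs_add_closed:
  assumes "x \<in> carrier seqs" "y \<in> carrier seqs"
  shows "(\<lambda>k. x k \<oplus>\<^bsub>S k\<^esub> y k) \<in> carrier seqs"
proof -
  have "\<forall>\<^sub>F k in sequentially. \<phi> k (x k) = x (Suc k)" "\<forall>\<^sub>F k in sequentially. \<phi> k (y k) = y (Suc k)"
    using assms by (auto simp: carrier_seqs_iff)
  then have "\<forall>\<^sub>F k in sequentially. \<phi> k (x k \<oplus>\<^bsub>S k\<^esub> y k) = x (Suc k) \<oplus>\<^bsub>S (Suc k)\<^esub> y (Suc k)"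
    by eventually_elim (use assms in \<open>simp add: carrier_seqs_iff\<close>)
  then show ?thesis using assms by (simp add: carrier_seqs_iff)
qed

lemma seqs_smult_closed:
  assumes "x \<in> carrier seqs"
  shows "(\<lambda>k. a \<odot>\<^bsub>S k\<^esub> x k) \<in> carrier seqs"
proof -
  have "\<forall>\<^sub>F k in sequentially. \<phi> k (x k) = x (Suc k)"
    using assms by (auto simp: carrier_seqs_iff)
  then have "\<forall>\<^sub>F k in sequentially. \<phi> k (a \<odot>\<^bsub>S k\<^esub> x k) = a \<odot>\<^bsub>S (Suc k)\<^esub> x (Suc k)"
    by eventually_elim (use assms in \<open>simp add: carrier_seqs_iff \<phi>.smult\<close>)
  then show ?thesis using assms by (simp add: carrier_seqs_iff)
qed

lemma seqs_minus_closed: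
  assumes "x \<in> carrier seqs"
  shows "(\<lambda>k. \<ominus>\<^bsub>S k\<^esub> x k) \<in> carrier seqs"
proof -
  have "\<forall>\<^sub>F k in sequentially. \<phi> k (x k) = x (Suc k)"
    using assms by (auto simp: carrier_seqs_iff)
  then have "\<forall>\<^sub>F k in sequentially. \<phi> k (\<ominus>\<^bsub>S k\<^esub> x k) = \<ominus>\<^bsub>S (Suc k)\<^esub> x (Suc k)"
    by eventually_elim (use assms in \<open>simp add: carrier_seqs_iff\<close>)
  then show ?thesis using assms by (simp add: carrier_seqs_iff)
qed

lemma abelian_group_seqs: "abelian_group seqs"
proof (rule abelian_groupI, goal_cases)
  case (6 x)
  then show ?case
    by (intro bexI [OF _ seqs_minus_closed [of x]]) (auto simp: carrier_seqs_iff S.M.l_neg)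
next
  case (1 x y)
  then show ?case by (simp add: seqs_add_closed)
qed (auto simp: carrier_seqs_iff S.M.a_ac)

sublocale seqs: abelian_group seqs
  by (rule abelian_group_seqs)

lemma seqs_minus: "x \<in> carrier seqs \<Longrightarrow> \<ominus>\<^bsub>seqs\<^esub> x = (\<lambda>k. \<ominus>\<^bsub>S k\<^esub> x k)"
  using seqs_minus_closed [of x]
  by (intro seqs.minus_equality) (simp_all add: seqs_coord S.M.l_neg)

lemma null_iff: "x \<in> nulls \<longleftrightarrow> x \<in> carrier seqs \<and> (\<forall>\<^sub>F k in sequentially. x k = \<zero>\<^bsub>S k\<^esub>)"
  by (simp add: null_seqs_def)

sublocale null: abelian_subgroup nulls seqs
proof (rule abelian_subgroupI3 [OF additive_subgroupI abelian_group_seqs],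
    rule seqs.add.subgroupI, goal_cases)
  case 2
  show ?case using seqs.zero_closed by (force simp: null_iff)
next
  case (3 x)
  then have "\<forall>\<^sub>F k in sequentially. x k = \<zero>\<^bsub>S k\<^esub>" by (simp add: null_iff)
  then have "\<forall>\<^sub>F k in sequentially. \<ominus>\<^bsub>S k\<^esub> x k = \<zero>\<^bsub>S k\<^esub>" by eventually_elim simp
  with 3 show ?case
    \<comment> \<open>The subgroup rule speaks of the inverse in the additive monoid, which is
      \<open>\<ominus>\<close>.\<close>
    unfolding a_inv_def [symmetric]
    by (auto simp: null_iff seqs_minus seqs_minus_closed)
next
  case (4 x y)
  then have "\<forall>\<^sub>F k in sequentially. x k = \<zero>\<^bsub>S k\<^esub>" "\<forall>\<^sub>F k in sequentially. y k = \<zero>\<^bsub>S k\<^esub>"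
    by (simp_all add: null_iff)
  then have "\<forall>\<^sub>F k in sequentially. x k \<oplus>\<^bsub>S k\<^esub> y k = \<zero>\<^bsub>S k\<^esub>" by eventually_elim simp
  with 4 show ?case
    by (auto simp: null_iff seqs_add_closed)
qed (auto simp: null_iff)

text \<open>Cosets agree when the difference is a null sequence, that is, when it is eventually
  zero.\<close>

lemma coset_eq_iff:
  assumes x: "x \<in> carrier seqs" and y: "y \<in> carrier seqs"
  shows "nulls +>\<^bsub>seqs\<^esub> x = nulls +>\<^bsub>seqs\<^esub> y \<longleftrightarrow> (\<forall>\<^sub>F k in sequentially. x k = y k)"
proof -
  have "nulls +>\<^bsub>seqs\<^esub> x = nulls +>\<^bsub>seqs\<^esub> y \<longleftrightarrow> x \<ominus>\<^bsub>seqs\<^esub> y \<in> nulls"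
    using null.a_rcos_module [OF y x] null.a_rcos_self [OF x]
      seqs.a_repr_independence [OF _ y null.a_subgroup]
    by (metis a_minus_def)
  also have "\<dots> \<longleftrightarrow> (\<forall>\<^sub>F k in sequentially. x k \<ominus>\<^bsub>S k\<^esub> y k = \<zero>\<^bsub>S k\<^esub>)"
    using seqs.minus_closed [OF x y] seqs_minus [OF y] by (simp add: null_iff a_minus_def)
  also have "\<dots> \<longleftrightarrow> (\<forall>\<^sub>F k in sequentially. x k = y k)"
    using x y by (intro eventually_subst always_eventually) (simp add: carrier_seqs_iff S.diff_eq_zero_iff)
  finally show ?thesis .
qed

text \<open>Compatibility can fail only in the jump from index \<open>k - 1\<close> to
  \<open>k\<close>, hence the threshold \<open>k\<close>.\<close>

lemma tail_in_seqs:
  "x \<in> carrier (S k) \<Longrightarrow> (\<lambda>i. if i < k then \<zero>\<^bsub>S i\<^esub> else con k i x) \<in> carrier seqs"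
  by (auto simp: carrier_seqs_iff connect_Suc intro!: eventually_sequentiallyI [of k])

lemma lim_eq_iff:
  assumes "x \<in> carrier (S k)" "y \<in> carrier (S l)"
  shows "\<iota> k x = \<iota> l y \<longleftrightarrow> (\<forall>\<^sub>F m in sequentially. con k m x = con l m y)"
  unfolding lim_map_def coset_eq_iff [OF tail_in_seqs tail_in_seqs, OF assms]
  \<comment> \<open>From \<open>max k l\<close> on, both tails have left their initial
    zeros.\<close>
  by (rule eventually_subst, rule eventually_sequentiallyI [of "max k l"]) simp

lemma lim_connect: "x \<in> carrier (S k) \<Longrightarrow> k \<le> l \<Longrightarrow> \<iota> l (con k l x) = \<iota> k x"
  by (subst lim_eq_iff) (auto simp: connect_connect intro!: eventually_sequentiallyI [of l])

lemma lim_connect_mat: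
  "X \<in> carrier (Mat n (S k)) \<Longrightarrow> k \<le> l \<Longrightarrow> map_mat (\<iota> l) (map_mat (con k l) X) = map_mat (\<iota> k) X"
  by (auto simp: carrier_Mat_iff lim_connect)

lemma lim_eqE:
  assumes "x \<in> carrier (S k)" "y \<in> carrier (S l)" "\<iota> k x = \<iota> l y"
  obtains m where "k \<le> m" "l \<le> m" "con k m x = con l m y"
proof -
  have "\<forall>\<^sub>F m in sequentially. con k m x = con l m y \<and> max k l \<le> m"
    using assms by (simp add: lim_eq_iff eventually_ge_at_top eventually_conj)
  then show thesis
    using that by (auto dest: eventually_happens)
qed

text \<open>Each pair of entries agrees from some stage on; as there are finitely many entries, one
  stage serves for all.\<close>

lemma lim_mat_eqE:
  assumes "X \<in> carrier (Mat n (S k))" "Y \<in> carrier (Mat n (S l))"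
    and "map_mat (\<iota> k) X = map_mat (\<iota> l) Y"
  obtains m where "k \<le> m" "l \<le> m" "map_mat (con k m) X = map_mat (con l m) Y"
proof -
  have *: "\<forall>\<^sub>F m in sequentially. \<forall>i\<in>{..<n}. \<forall>j\<in>{..<n}. con k m (X $$ (i, j)) = con l m (Y $$ (i, j))"
    using assms
    by (intro eventually_ball_finite ballI)
      (auto simp: carrier_Mat_iff mat_eq_iff simp flip: lim_eq_iff)
  have "\<forall>\<^sub>F m in sequentially. max k l \<le> m \<and> map_mat (con k m) X = map_mat (con l m) Y"
    using * eventually_ge_at_top [of "max k l"]
    by eventually_elim (use assms in \<open>auto simp: carrier_Mat_iff mat_eq_iff\<close>)
  then show thesis
    using that by (auto dest: eventually_happens)
qed

lemma L_simps:
  "carrier L = a_rcosets\<^bsub>seqs\<^esub> nulls"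
  "\<zero>\<^bsub>L\<^esub> = nulls"
  "c \<oplus>\<^bsub>L\<^esub> d = c <+>\<^bsub>seqs\<^esub> d"
  "a \<odot>\<^bsub>L\<^esub> c = (\<Union>x\<in>c. nulls +>\<^bsub>seqs\<^esub> (a \<odot>\<^bsub>seqs\<^esub> x))"
  by (simp_all add: lim_space_def)

section \<open>Representing elements and matrices of the limit at a single stage\<close>

lemma lim_closed: "x \<in> carrier (S k) \<Longrightarrow> \<iota> k x \<in> carrier L"
  by (simp add: L_simps lim_map_def seqs.a_rcosetsI [OF null.a_subset tail_in_seqs])

text \<open>Once a representing sequence \<open>s\<close> is compatible from \<open>k\<close> on,
  its later terms are the images of \<open>s k\<close>, so its class is
  \<open>\<iota> k (s k)\<close>.\<close>

lemma carrier_L_cases: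
  assumes "c \<in> carrier L"
  obtains k x where "x \<in> carrier (S k)" "c = \<iota> k x"
proof -
  obtain s where s: "s \<in> carrier seqs" "c = nulls +>\<^bsub>seqs\<^esub> s"
    using assms by (auto simp: L_simps A_RCOSETS_def')
  then obtain k where k: "\<And>i. i \<ge> k \<Longrightarrow> \<phi> i (s i) = s (Suc i)"
    by (auto simp: carrier_seqs_iff eventually_sequentially)
  have *: "con k i (s k) = s i" if "k \<le> i" for i
    using that by (induction i rule: dec_induct) (auto simp: connect_Suc k)
  have sk: "s k \<in> carrier (S k)"
    using s by (simp add: carrier_seqs_iff)
  have "c = \<iota> k (s k)"
    unfolding s(2) lim_map_def
    using coset_eq_iff [OF s(1) tail_in_seqs [OF sk]] *
    by (auto intro!: eventually_sequentiallyI [of k])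
  then show thesis using that sk by blast
qed

lemma lim_image_mono: "k \<le> l \<Longrightarrow> \<iota> k ` carrier (S k) \<subseteq> \<iota> l ` carrier (S l)"
  by (intro image_subsetI, subst lim_connect [symmetric]) (auto intro!: imageI)

text \<open>The images of the stages form an increasing chain that covers the limit, so a finite set
  lies in one of them.\<close>

lemma finite_common_index:
  assumes "finite F" "F \<subseteq> carrier L"
  shows "\<exists>k. F \<subseteq> \<iota> k ` carrier (S k)"
  using assms
proof (induction F)
  case (insert c F)
  then obtain k where k: "F \<subseteq> \<iota> k ` carrier (S k)" by auto
  obtain l z where "z \<in> carrier (S l)" "c = \<iota> l z"
    using insert.prems by (auto elim: carrier_L_cases)
  then have "insert c F \<subseteq> \<iota> (max k l) ` carrier (S (max k l))"
    using k lim_image_mono [of k "max k l"] lim_image_mono [of l "max k l"] by auto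
  then show ?case by blast
qed auto

text \<open>Associativity needs three elements; laws in two elements use this with one element
  repeated.\<close>

lemma carrier_L_cases3:
  assumes "c \<in> carrier L" "d \<in> carrier L" "e \<in> carrier L"
  obtains k x y z where "x \<in> carrier (S k)" "c = \<iota> k x" "y \<in> carrier (S k)" "d = \<iota> k y"
    "z \<in> carrier (S k)" "e = \<iota> k z"
  using finite_common_index [of "{c, d, e}"] assms by auto

lemma carrier_Mat_L_cases:
  assumes "X \<in> carrier (Mat n L)"
  obtains k Y where "Y \<in> carrier (Mat n (S k))" "X = map_mat (\<iota> k) Y"
proof -
  have "(\<lambda>ij. X $$ ij) ` ({..<n} \<times> {..<n}) \<subseteq> carrier L"
    using assms by (auto simp: carrier_Mat_iff)
  then obtain k where "(\<lambda>ij. X $$ ij) ` ({..<n} \<times> {..<n}) \<subseteq> \<iota> k ` carrier (S k)"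
    using finite_common_index [of "(\<lambda>ij. X $$ ij) ` ({..<n} \<times> {..<n})"] by auto
  then have "\<forall>i<n. \<forall>j<n. \<exists>x. x \<in> carrier (S k) \<and> X $$ (i, j) = \<iota> k x"
    by (auto simp: subset_iff image_iff)
  then obtain f where "\<And>i j. i < n \<Longrightarrow> j < n \<Longrightarrow> f i j \<in> carrier (S k) \<and> X $$ (i, j) = \<iota> k (f i j)"
    by metis
  then show thesis
    using assms by (intro that [of "mat n n (\<lambda>(i, j). f i j)" k]) (auto simp: carrier_Mat_iff)
qed

section \<open>Vector space structure of the limit\<close>

lemma lim_add:
  assumes "x \<in> carrier (S k)" "y \<in> carrier (S k)"
  shows "\<iota> k (x \<oplus>\<^bsub>S k\<^esub> y) = \<iota> k x \<oplus>\<^bsub>L\<^esub> \<iota> k y"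
proof -
  have "(\<lambda>i. if i < k then \<zero>\<^bsub>S i\<^esub> else con k i (x \<oplus>\<^bsub>S k\<^esub> y)) =
      (\<lambda>i. if i < k then \<zero>\<^bsub>S i\<^esub> else con k i x) \<oplus>\<^bsub>seqs\<^esub> (\<lambda>i. if i < k then \<zero>\<^bsub>S i\<^esub> else con k i y)"
    using assms by (auto simp: complex_linear.add [OF connect_linear])
  then show ?thesis
    using null.a_rcos_sum [OF tail_in_seqs tail_in_seqs, OF assms] by (simp add: L_simps lim_map_def)
qed

text \<open>A scalar multiple of a coset is a union over all representatives, so these must all
  contribute the same coset. They do: representatives agree eventually, and so do their
  multiples.\<close>

lemma lim_smult:
  assumes "x \<in> carrier (S k)"
  shows "\<iota> k (a \<odot>\<^bsub>S k\<^esub> x) = a \<odot>\<^bsub>L\<^esub> \<iota> k x"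
proof -
  let ?t = "\<lambda>i. if i < k then \<zero>\<^bsub>S i\<^esub> else con k i x"
  have t: "?t \<in> carrier seqs" by (rule tail_in_seqs [OF assms])
  have "(\<lambda>i. if i < k then \<zero>\<^bsub>S i\<^esub> else con k i (a \<odot>\<^bsub>S k\<^esub> x)) = a \<odot>\<^bsub>seqs\<^esub> ?t"
    using assms by (auto simp: complex_linear.smult [OF connect_linear])
  then have *: "\<iota> k (a \<odot>\<^bsub>S k\<^esub> x) = nulls +>\<^bsub>seqs\<^esub> (a \<odot>\<^bsub>seqs\<^esub> ?t)"
    by (simp add: lim_map_def)
  have "nulls +>\<^bsub>seqs\<^esub> (a \<odot>\<^bsub>seqs\<^esub> s) = nulls +>\<^bsub>seqs\<^esub> (a \<odot>\<^bsub>seqs\<^esub> ?t)" if "s \<in> \<iota> k x" for s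
  proof -
    have s: "s \<in> carrier seqs"
      using that seqs.a_r_coset_subset_G [OF null.a_subset t] by (auto simp: lim_map_def)
    have "nulls +>\<^bsub>seqs\<^esub> s = nulls +>\<^bsub>seqs\<^esub> ?t"
      using seqs.a_repr_independence [OF _ t null.a_subgroup] that by (auto simp: lim_map_def)
    then have "\<forall>\<^sub>F i in sequentially. s i = ?t i"
      by (simp only: coset_eq_iff [OF s t])
    then show ?thesis
      by (subst coset_eq_iff [OF seqs_smult_closed [OF s, of a] seqs_smult_closed [OF t, of a], folded seqs_simps])
        (auto elim: eventually_mono)
  qed
  \<comment> \<open>The union has at least one member, so it equals the common coset.\<close>
  moreover have "?t \<in> \<iota> k x"
    unfolding lim_map_def by (rule null.a_rcos_self [OF t])
  ultimately show ?thesis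
    unfolding * L_simps(4) by blast
qed

lemma lim_zero: "\<iota> k \<zero>\<^bsub>S k\<^esub> = \<zero>\<^bsub>L\<^esub>"
proof -
  have "(\<lambda>i. if i < k then \<zero>\<^bsub>S i\<^esub> else con k i \<zero>\<^bsub>S k\<^esub>) = \<zero>\<^bsub>seqs\<^esub>"
    by (auto simp: complex_linear.zero [OF connect_linear])
  then show ?thesis
    by (simp add: L_simps lim_map_def null.a_subset seqs.a_coset_add_zero [simplified])
qed


lemma abelian_group_L: "abelian_group L"
proof (rule abelian_groupI, goal_cases)
  case (1 c d)
  then obtain k x y where "x \<in> carrier (S k)" "c = \<iota> k x" "y \<in> carrier (S k)" "d = \<iota> k y"
    by (rule carrier_L_cases3 [OF _ _ 1(1)]) blast
  then show ?case by (simp add: lim_add [symmetric] lim_closed)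
next
  case 2
  show ?case unfolding lim_zero [of 0, symmetric] by (simp add: lim_closed)
next
  case (3 c d e)
  then obtain k x y z where "x \<in> carrier (S k)" "c = \<iota> k x" "y \<in> carrier (S k)" "d = \<iota> k y"
    "z \<in> carrier (S k)" "e = \<iota> k z"
    by (rule carrier_L_cases3)
  then show ?case by (simp add: lim_add [symmetric] S.M.a_assoc)
next
  case (4 c d)
  then obtain k x y where "x \<in> carrier (S k)" "c = \<iota> k x" "y \<in> carrier (S k)" "d = \<iota> k y"
    by (rule carrier_L_cases3 [OF _ _ 4(1)]) blast
  then show ?case by (simp add: lim_add [symmetric] S.M.a_comm)
next
  case (5 c)
  then obtain k x where "x \<in> carrier (S k)" "c = \<iota> k x" by (rule carrier_L_cases)
  then show ?case by (simp add: lim_zero [of k, symmetric] lim_add [symmetric])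
next
  case (6 c)
  then obtain k x where "x \<in> carrier (S k)" "c = \<iota> k x" by (rule carrier_L_cases)
  then show ?case
    by (intro bexI [of _ "\<iota> k (\<ominus>\<^bsub>S k\<^esub> x)"])
      (simp_all add: lim_zero [of k, symmetric] lim_add [symmetric] lim_closed S.M.l_neg)
qed

lemma module_L: "module complex_field L"
proof (rule moduleI [OF _ abelian_group_L], goal_cases)
  case 1
  \<comment> \<open>That \<open>complex_field\<close> is a commutative ring is part of the module
    structure of each \<open>S k\<close>.\<close>
  show ?case by (rule module.axioms(1) [OF S.module_axioms])
next
  case (2 a c)
  from 2(2) obtain k x where "x \<in> carrier (S k)" "c = \<iota> k x" by (rule carrier_L_cases)
  then show ?case by (simp add: lim_smult [symmetric] lim_closed)
next
  case (3 a b c)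
  from 3(3) obtain k x where "x \<in> carrier (S k)" "c = \<iota> k x" by (rule carrier_L_cases)
  then show ?case
    by (simp add: lim_smult [symmetric] lim_add [symmetric] S.smult_l_distr [simplified])
next
  case (4 a c d)
  from 4(2,3) obtain k x y where "x \<in> carrier (S k)" "c = \<iota> k x" "y \<in> carrier (S k)" "d = \<iota> k y"
    by (rule carrier_L_cases3 [OF _ _ 4(2)]) blast
  then show ?case
    by (simp add: lim_smult [symmetric] lim_add [symmetric] S.smult_r_distr [simplified])
next
  case (5 a b c)
  from 5(3) obtain k x where "x \<in> carrier (S k)" "c = \<iota> k x" by (rule carrier_L_cases)
  then show ?case by (simp add: lim_smult [symmetric] S.smult_assoc1 [simplified])
next
  case (6 c)
  then obtain k x where "x \<in> carrier (S k)" "c = \<iota> k x" by (rule carrier_L_cases)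
  then show ?case by (simp add: lim_smult [symmetric])
qed

sublocale L: complex_space L
  by (rule complex_space.intro [OF module_L])

sublocale lim: complex_linear "S k" L "\<iota> k" for k
  by unfold_locales (auto simp: linear_on_def lim_closed lim_add lim_smult)

section \<open>Gluing compatible families; involution and unit of the limit\<close>

lemma compatible_connect:
  assumes "\<And>k x. x \<in> carrier (S k) \<Longrightarrow> \<beta> (Suc k) (\<phi> k x) = \<beta> k x"
    and "k \<le> l" "x \<in> carrier (S k)"
  shows "\<beta> l (con k l x) = \<beta> k x"
  using assms(2) by (induction l rule: dec_induct) (simp_all add: connect_Suc assms)

text \<open>Two representatives of an element meet at a later stage, where a compatible family gives
  both the same value. The description has the form used for \<open>star\<close> in
  \<open>lim_space\<close> and for the induced map in \<open>factorization\<close>.\<close>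

lemma the_compatible_value:
  assumes compat: "\<And>k x. x \<in> carrier (S k) \<Longrightarrow> \<beta> (Suc k) (\<phi> k x) = \<beta> k x"
    and x: "x \<in> carrier (S k)"
  shows "(THE d. \<exists>l. \<exists>y\<in>carrier (S l). \<iota> k x = \<iota> l y \<and> d = \<beta> l y) = \<beta> k x"
proof (rule the_equality)
  fix d
  assume "\<exists>l. \<exists>y\<in>carrier (S l). \<iota> k x = \<iota> l y \<and> d = \<beta> l y"
  then obtain l y where y: "y \<in> carrier (S l)" "\<iota> k x = \<iota> l y" "d = \<beta> l y"
    by blast
  obtain m where "k \<le> m" "l \<le> m" "con k m x = con l m y"
    using lim_eqE [OF x y(1,2)] .
  then show "d = \<beta> k x"
    using x y compatible_connect [of \<beta>, OF compat] by metis
qed (use x in blast)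

lemma lim_step: "x \<in> carrier (S k) \<Longrightarrow> \<iota> (Suc k) (\<phi> k x) = \<iota> k x"
  using lim_connect [of x k "Suc k"] by (simp add: connect_Suc)

text \<open>Gluing applies to the family \<open>\<iota> k (star (S k) x)\<close>: it is compatible
  because each \<open>\<phi> k\<close> preserves the involution by
  \<open>MOU_hom_star\<close>.\<close>

lemma star_lim: "x \<in> carrier (S k) \<Longrightarrow> star L (\<iota> k x) = \<iota> k (star (S k) x)"
  using the_compatible_value [of "\<lambda>k x. \<iota> k (star (S k) x)" x k]
  by (simp add: lim_space_def lim_step S.star_closed
      MOU_hom_star [OF S.MOU_object_axioms S.MOU_object_axioms \<phi>_hom, symmetric])

text \<open>The unit is taken from stage 0, and the unital connecting maps carry it to every other
  stage.\<close>

lemma ounit_lim: "\<iota> k (ounit (S k)) = ounit L"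
  using lim_connect [of "ounit (S 0)" 0 k] by (simp add: lim_space_def connect_ounit S.ounit_closed)

sublocale L: star_vector_space L
proof
  fix c d a
  assume c: "c \<in> carrier L"
  then obtain k x where "x \<in> carrier (S k)" "c = \<iota> k x" by (rule carrier_L_cases)
  then show "star L c \<in> carrier L" "star L (star L c) = c" "star L (a \<odot>\<^bsub>L\<^esub> c) = cnj a \<odot>\<^bsub>L\<^esub> star L c"
    by (simp_all add: star_lim S.star_closed S.star_star S.star_smult flip: lim.smult)
  assume "d \<in> carrier L"
  with c obtain k x y where "x \<in> carrier (S k)" "c = \<iota> k x" "y \<in> carrier (S k)" "d = \<iota> k y"
    by (rule carrier_L_cases3 [OF _ _ c]) blast
  then show "star L (c \<oplus>\<^bsub>L\<^esub> d) = star L c \<oplus>\<^bsub>L\<^esub> star L d"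
    by (simp add: star_lim S.star_closed S.star_add lim_add [symmetric] del: lim.hom_add)
qed

section \<open>Cones and Hermitian matrices of the limit\<close>

lemma cone_L: "n \<ge> 1 \<Longrightarrow> cone L n = (\<Union>m. map_mat (\<iota> m) ` cone (S m) n)"
proof (intro equalityI subsetI)
  fix X
  assume n: "n \<ge> 1" and "X \<in> cone L n"
  then obtain k Y m where "X = map_mat (\<iota> k) Y" "Y \<in> carrier (Mat n (S k))" "k \<le> m"
    "map_mat (con k m) Y \<in> cone (S m) n"
    by (auto simp: lim_space_def)
  \<comment> \<open>A matrix that becomes positive at stage \<open>m\<close> is replaced by its
    image there, which represents the same \<open>X\<close>.\<close>
  then show "X \<in> (\<Union>m. map_mat (\<iota> m) ` cone (S m) n)"
    using lim_connect_mat [of Y n k m] by (intro UN_I [of m] image_eqI) simp_all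
next
  fix X
  assume n: "n \<ge> 1" and "X \<in> (\<Union>m. map_mat (\<iota> m) ` cone (S m) n)"
  then obtain k Y where Y: "X = map_mat (\<iota> k) Y" "Y \<in> cone (S k) n"
    by blast
  \<comment> \<open>Stage \<open>k\<close> itself is the witness for eventual positivity.\<close>
  then have "map_mat (con k k) Y \<in> cone (S k) n"
    using connect_cone [OF order_refl n] by blast
  then show "X \<in> cone L n"
    using Y S.cone_carrier [OF n] by (auto simp: lim_space_def simp del: connect_self)
qed

lemma lim_cone: "n \<ge> 1 \<Longrightarrow> X \<in> cone (S k) n \<Longrightarrow> map_mat (\<iota> k) X \<in> cone L n"
  by (auto simp: cone_L)

lemma cone_L_cases:
  assumes "n \<ge> 1" "X \<in> cone L n"
  obtains k Y where "Y \<in> cone (S k) n" "X = map_mat (\<iota> k) Y"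
  using assms by (auto simp: cone_L)

lemma cone_L_cases2:
  assumes n: "n \<ge> 1" and X: "X \<in> cone L n" and Y: "Y \<in> cone L n"
  obtains k A B where "A \<in> cone (S k) n" "X = map_mat (\<iota> k) A" "B \<in> cone (S k) n" "Y = map_mat (\<iota> k) B"
proof -
  obtain k A where A: "A \<in> cone (S k) n" "X = map_mat (\<iota> k) A" using n X by (rule cone_L_cases)
  obtain l B where B: "B \<in> cone (S l) n" "Y = map_mat (\<iota> l) B" using n Y by (rule cone_L_cases)
  show thesis
  proof
    show "map_mat (con k (max k l)) A \<in> cone (S (max k l)) n"
      "map_mat (con l (max k l)) B \<in> cone (S (max k l)) n"
      using n A B by (simp_all add: connect_cone)
    show "X = map_mat (\<iota> (max k l)) (map_mat (con k (max k l)) A)"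
      "Y = map_mat (\<iota> (max k l)) (map_mat (con l (max k l)) B)"
      unfolding A(2) B(2)
      using lim_connect_mat [OF S.cone_carrier [OF n A(1)], of "max k l"]
        lim_connect_mat [OF S.cone_carrier [OF n B(1)], of "max k l"] by simp_all
  qed
qed

lemma lim_herm: "X \<in> herm n (S k) \<Longrightarrow> map_mat (\<iota> k) X \<in> herm n L"
  by (auto simp: herm_iff lim.map_mat_carrier) (auto simp: carrier_Mat_iff star_lim)

text \<open>A representative \<open>A\<close> need not be Hermitian. But \<open>A\<close> and its
  adjoint have the same image in the limit, hence the same image at some stage \<open>m\<close>, and
  that image is Hermitian.\<close>

lemma herm_L_cases:
  assumes "X \<in> herm n L"
  obtains k Y where "Y \<in> herm n (S k)" "X = map_mat (\<iota> k) Y"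
proof -
  have "X \<in> carrier (Mat n L)" using assms by (simp add: herm_def)
  then obtain k A where A: "A \<in> carrier (Mat n (S k))" "X = map_mat (\<iota> k) A"
    by (rule carrier_Mat_L_cases)
  have sA: "mat_star (S k) A \<in> carrier (Mat n (S k))"
    using A by (auto simp: mat_star_carrier) (auto simp: carrier_Mat_iff S.star_closed)
  have "map_mat (\<iota> k) (mat_star (S k) A) = mat_star L X"
    using A by (auto simp: mat_star_def carrier_Mat_iff star_lim)
  also have "\<dots> = map_mat (\<iota> k) A"
    using assms A by (simp add: herm_def)
  finally obtain m where m: "k \<le> m" "map_mat (con k m) (mat_star (S k) A) = map_mat (con k m) A"
    using lim_mat_eqE [OF sA A(1)] by metis
  interpret con: complex_linear "S k" "S m" "con k m" by (rule connect_linear [OF m(1)])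
  have "mat_star (S m) (map_mat (con k m) A) = map_mat (con k m) (mat_star (S k) A)"
    using A(1) m(1) by (auto simp: mat_star_def carrier_Mat_iff connect_star)
  then have "map_mat (con k m) A \<in> herm n (S m)"
    using m(2) con.map_mat_carrier [OF A(1)] by (simp add: herm_def)
  moreover have "X = map_mat (\<iota> m) (map_mat (con k m) A)"
    unfolding A(2) using lim_connect_mat [OF A(1) m(1)] by simp
  ultimately show thesis by (rule that)
qed

section \<open>Matrix ordering and order unit of the limit\<close>

sublocale L: matrix_ordered_space L
proof
  fix n :: nat
  assume n: "n \<ge> 1"
  interpret LMn: abelian_group "Mat n L" by (rule L.abelian_group_Mat)
  show "cone L n \<subseteq> herm n L"
    using n S.cone_herm [OF n] by (auto simp: cone_L intro!: lim_herm)
  have zero: "\<zero>\<^bsub>Mat n L\<^esub> \<in> cone L n"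
    using lim_cone [OF n S.zero_in_cone [OF n]] lim.map_mat_zero [of _ n] by simp
  then show "cone L n \<noteq> {}" by blast
  show "cone L n \<inter> (\<lambda>X. \<ominus>\<^bsub>Mat n L\<^esub> X) ` cone L n = {\<zero>\<^bsub>Mat n L\<^esub>}"
  proof (intro equalityI subsetI)
    fix X
    assume "X \<in> cone L n \<inter> (\<lambda>X. \<ominus>\<^bsub>Mat n L\<^esub> X) ` cone L n"
    then obtain Y where XY: "X \<in> cone L n" "Y \<in> cone L n" "X = \<ominus>\<^bsub>Mat n L\<^esub> Y"
      by blast
    obtain k A B where AB: "A \<in> cone (S k) n" "X = map_mat (\<iota> k) A"
      "B \<in> cone (S k) n" "Y = map_mat (\<iota> k) B"
      using cone_L_cases2 [OF n XY(1,2)] .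
    note AB_carrier = S.cone_carrier [OF n AB(1)] S.cone_carrier [OF n AB(3)]
    have AB_sum: "A \<oplus>\<^bsub>Mat n (S k)\<^esub> B \<in> carrier (Mat n (S k))"
      by (rule S.cone_carrier [OF n S.cone_add [OF n AB(1,3)]])
    have zero_carrier: "\<zero>\<^bsub>Mat n (S k)\<^esub> \<in> carrier (Mat n (S k))"
      by simp
    have "Y \<in> carrier (Mat n L)"
      using AB(4) AB_carrier(2) lim.map_mat_carrier by blast
    then have "X \<oplus>\<^bsub>Mat n L\<^esub> Y = \<zero>\<^bsub>Mat n L\<^esub>"
      unfolding XY(3) by (rule LMn.l_neg)
    \<comment> \<open>Zero is also written as an image from stage \<open>k\<close>, so that
      \<open>lim_mat_eqE\<close> applies to the equation.\<close>
    then have "map_mat (\<iota> k) (A \<oplus>\<^bsub>Mat n (S k)\<^esub> B) = map_mat (\<iota> k) \<zero>\<^bsub>Mat n (S k)\<^esub>"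
      using AB by (simp only: lim.map_mat_add [OF AB_carrier] lim.map_mat_zero)
    then obtain m where m: "k \<le> m"
      "map_mat (con k m) (A \<oplus>\<^bsub>Mat n (S k)\<^esub> B) = map_mat (con k m) \<zero>\<^bsub>Mat n (S k)\<^esub>"
      using lim_mat_eqE [OF AB_sum zero_carrier] by metis
    interpret con: complex_linear "S k" "S m" "con k m" by (rule connect_linear [OF m(1)])
    have "map_mat (con k m) A \<oplus>\<^bsub>Mat n (S m)\<^esub> map_mat (con k m) B = \<zero>\<^bsub>Mat n (S m)\<^esub>"
      using m(2) by (simp only: con.map_mat_add [OF AB_carrier] con.map_mat_zero)
    \<comment> \<open>Complete positivity keeps both summands positive at stage \<open>m\<close>, so
      properness of the cone of \<open>S m\<close> applies.\<close>
    then have "map_mat (con k m) A = \<zero>\<^bsub>Mat n (S m)\<^esub>"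
      by (rule S.cone_antisym [OF n connect_cone [OF m(1) n AB(1)] connect_cone [OF m(1) n AB(3)]])
    then have "X = \<zero>\<^bsub>Mat n L\<^esub>"
      using AB(2) lim_connect_mat [OF AB_carrier(1) m(1)] by (metis lim.map_mat_zero)
    then show "X \<in> {\<zero>\<^bsub>Mat n L\<^esub>}" by simp
  next
    fix X
    assume "X \<in> {\<zero>\<^bsub>Mat n L\<^esub>}"
    then show "X \<in> cone L n \<inter> (\<lambda>X. \<ominus>\<^bsub>Mat n L\<^esub> X) ` cone L n"
      \<comment> \<open>Zero is positive and its own negative.\<close>
      using zero LMn.add.inv_one [folded a_inv_def] by (metis IntI image_eqI singletonD)
  qed
  fix X
  assume X: "X \<in> cone L n"
  then obtain k A where A: "A \<in> cone (S k) n" "X = map_mat (\<iota> k) A"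
    by (rule cone_L_cases [OF n])
  note A_carrier = S.cone_carrier [OF n A(1)]
  \<comment> \<open>The remaining closure properties hold at one stage, and the amplification of
    \<open>\<iota> k\<close> commutes with the operation concerned.\<close>
  show "complex_of_real r \<odot>\<^bsub>Mat n L\<^esub> X \<in> cone L n" if "r \<ge> 0" for r
    using lim_cone [OF n S.cone_smult [OF n that A(1)]]
    unfolding A(2) lim.map_mat_smult [OF A_carrier] .
  show "compress L \<alpha> X \<in> cone L m" if m: "m \<ge> 1" and \<alpha>: "\<alpha> \<in> carrier_mat n m" for m \<alpha>
    using lim_cone [OF m S.cone_compress [OF n m \<alpha> A(1)]]
    unfolding A(2) lim.map_mat_compress [OF \<alpha> A_carrier] .
  fix Y
  assume "Y \<in> cone L n"
  then obtain k A B where AB: "A \<in> cone (S k) n" "X = map_mat (\<iota> k) A"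
    "B \<in> cone (S k) n" "Y = map_mat (\<iota> k) B"
    by (rule cone_L_cases2 [OF n X])
  show "X \<oplus>\<^bsub>Mat n L\<^esub> Y \<in> cone L n"
    using lim_cone [OF n S.cone_add [OF n AB(1,3)]]
    unfolding AB lim.map_mat_add [OF S.cone_carrier [OF n AB(1)] S.cone_carrier [OF n AB(3)]] .
qed

sublocale L: MOU_object L
proof
  show "ounit L \<in> carrier L"
    unfolding ounit_lim [of 0, symmetric] by (simp add: S.ounit_closed)
  have "map_mat (\<iota> 0) (mat 1 1 (\<lambda>_. ounit (S 0))) = mat 1 1 (\<lambda>_. ounit L)"
    by (auto simp: ounit_lim)
  then show "mat 1 1 (\<lambda>_. ounit L) \<in> cone L 1"
    using lim_cone [OF _ S.ounit_cone [of 0]] by simp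
next
  fix n :: nat and X
  assume n: "n \<ge> 1" and "X \<in> herm n L"
  \<comment> \<open>With a Hermitian representative at hand, the bound \<open>r\<close> found in
    \<open>S k\<close> also serves in the limit.\<close>
  then obtain k A where A: "A \<in> herm n (S k)" "X = map_mat (\<iota> k) A"
    using herm_L_cases by blast
  have carrier: "diag_unit n (S k) \<in> carrier (Mat n (S k))" "A \<in> carrier (Mat n (S k))"
    using A S.ounit_closed by (auto simp: diag_unit_def herm_def)
  then have carrier': "complex_of_real r \<odot>\<^bsub>Mat n (S k)\<^esub> diag_unit n (S k) \<in> carrier (Mat n (S k))" for r
    by (auto simp: carrier_Mat_iff)
  obtain r where r: "r > 0"
    "complex_of_real r \<odot>\<^bsub>Mat n (S k)\<^esub> diag_unit n (S k) \<ominus>\<^bsub>Mat n (S k)\<^esub> A \<in> cone (S k) n"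
    using S.order_unit [OF n A(1)] by blast
  have "complex_of_real r \<odot>\<^bsub>Mat n L\<^esub> diag_unit n L \<ominus>\<^bsub>Mat n L\<^esub> X \<in> cone L n"
    using lim_cone [OF n r(2)]
    unfolding A(2) lim.map_mat_diff [OF carrier' carrier(2)] lim.map_mat_smult [OF carrier(1)]
      lim.map_mat_diag_unit [OF ounit_lim] .
  then show "\<exists>r>0. complex_of_real r \<odot>\<^bsub>Mat n L\<^esub> diag_unit n L \<ominus>\<^bsub>Mat n L\<^esub> X \<in> cone L n"
    using r(1) by blast
qed

section \<open>Universal property\<close>

lemma cocone_L: "MOU_cocone S \<phi> L \<iota>"
  by (simp add: MOU_cocone_def MOU_hom_def completely_positive_def L.MOU_object_axioms lim.linear
      lim_cone ounit_lim lim_step)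

lemma factorization:
  assumes "MOU_cocone S \<phi> B \<beta>"
  obtains \<mu> where "\<mu> \<in> MOU_hom L B" "\<And>k x. x \<in> carrier (S k) \<Longrightarrow> \<mu> (\<iota> k x) = \<beta> k x"
proof
  interpret B: MOU_object B using assms by (simp add: MOU_cocone_def)
  have \<beta>_hom: "\<beta> k \<in> MOU_hom (S k) B" for k
    using assms by (simp add: MOU_cocone_def)
  interpret \<beta>: complex_linear "S k" B "\<beta> k" for k
    using \<beta>_hom by unfold_locales (auto simp: MOU_hom_def)
  define \<mu> where "\<mu> c = (THE d. \<exists>k. \<exists>x\<in>carrier (S k). c = \<iota> k x \<and> d = \<beta> k x)" for c
  show \<mu>: "\<mu> (\<iota> k x) = \<beta> k x" if "x \<in> carrier (S k)" for k x
    unfolding \<mu>_def using assms that by (intro the_compatible_value) (auto simp: MOU_cocone_def)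
  have "linear_on L B \<mu>"
    unfolding linear_on_def
  proof (intro conjI ballI allI funcsetI)
    fix c d a
    assume c: "c \<in> carrier L"
    then obtain k x where "x \<in> carrier (S k)" "c = \<iota> k x" by (rule carrier_L_cases)
    then show "\<mu> c \<in> carrier B" "\<mu> (a \<odot>\<^bsub>L\<^esub> c) = a \<odot>\<^bsub>B\<^esub> \<mu> c"
      by (simp_all add: \<mu> \<beta>.smult flip: lim.smult)
    assume "d \<in> carrier L"
    with c obtain k x y where "x \<in> carrier (S k)" "c = \<iota> k x" "y \<in> carrier (S k)" "d = \<iota> k y"
      by (rule carrier_L_cases3 [OF _ _ c]) blast
    then show "\<mu> (c \<oplus>\<^bsub>L\<^esub> d) = \<mu> c \<oplus>\<^bsub>B\<^esub> \<mu> d"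
      by (simp add: \<mu> lim_add [symmetric] del: lim.hom_add)
  qed
  moreover have "completely_positive L B \<mu>"
    unfolding completely_positive_def
  proof (intro allI impI ballI)
    fix n X
    assume n: "1 \<le> n" and "X \<in> cone L n"
    then obtain k A where A: "A \<in> cone (S k) n" "X = map_mat (\<iota> k) A"
      by (rule cone_L_cases)
    \<comment> \<open>On the entries of \<open>A\<close>, \<open>\<mu>\<close> after
      \<open>\<iota> k\<close> is \<open>\<beta> k\<close>, so complete positivity is inherited from
      \<open>\<beta> k\<close>.\<close>
    have "map_mat \<mu> X = map_mat (\<beta> k) A"
      using S.cone_carrier [OF n A(1)] by (auto simp: A(2) carrier_Mat_iff \<mu>)
    then show "map_mat \<mu> X \<in> cone B n"
      using \<beta>_hom n A(1) by (simp add: MOU_hom_def completely_positive_def)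
  qed
  moreover have "\<mu> (ounit L) = ounit B"
    using \<mu> [OF S.ounit_closed, of 0] \<beta>_hom by (simp add: ounit_lim MOU_hom_def)
  ultimately show "\<mu> \<in> MOU_hom L B"
    by (simp add: MOU_hom_def)
qed

end

text \<open>Matrices in the cones have their entries in the carrier, so only values there matter.
  This allows a morphism to be replaced by its restriction.\<close>

lemma MOU_hom_cong:
  assumes "matrix_ordered_space S" "ounit S \<in> carrier S" "\<And>x. x \<in> carrier S \<Longrightarrow> f x = g x"
  shows "f \<in> MOU_hom S T \<longleftrightarrow> g \<in> MOU_hom S T"
proof -
  interpret matrix_ordered_space S by fact
  have "map_mat f X = map_mat g X" if "n \<ge> 1" "X \<in> cone S n" for n X
    using cone_carrier [OF that] assms(3) by (auto simp: carrier_Mat_iff)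
  moreover have "linear_on S T f \<longleftrightarrow> linear_on S T g"
    using assms(3) by (auto simp: linear_on_def Pi_iff)
  ultimately show ?thesis
    using assms(2,3) by (auto simp: MOU_hom_def completely_positive_def)
qed

theorem theorem4p6:
  fixes S :: "nat \<Rightarrow> 'a mou" and \<phi> :: "nat \<Rightarrow> 'a \<Rightarrow> 'a"
  assumes "MOU_system S \<phi>"
  shows "MOU_inductive_limit TYPE('b) S \<phi> (lim_space S \<phi>) (lim_map S \<phi>)"
proof -
  interpret MOU_inductive_system S \<phi> by standard (rule assms)
  show ?thesis
    unfolding MOU_inductive_limit_def
  proof (intro conjI allI impI cocone_L)
    fix B :: "'b mou" and \<beta>
    assume "MOU_cocone S \<phi> B \<beta>"
    then obtain \<mu> where \<mu>: "\<mu> \<in> MOU_hom L B" "\<And>k x. x \<in> carrier (S k) \<Longrightarrow> \<mu> (\<iota> k x) = \<beta> k x"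
      by (rule factorization) blast
    show "\<exists>!\<mu>. \<mu> \<in> extensional (carrier L) \<and> \<mu> \<in> MOU_hom L B \<and>
        (\<forall>k. \<forall>x\<in>carrier (S k). \<mu> (\<iota> k x) = \<beta> k x)"
    \<comment> \<open>Restricting to the carrier makes the induced map extensional.\<close>
    proof (intro ex1I [of _ "restrict \<mu> (carrier L)"] conjI ballI allI)
      show "restrict \<mu> (carrier L) \<in> MOU_hom L B"
        by (rule iffD2 [OF MOU_hom_cong [OF L.matrix_ordered_space_axioms L.ounit_closed] \<mu>(1)]) simp
    next
      fix \<nu>
      assume \<nu>: "\<nu> \<in> extensional (carrier L) \<and> \<nu> \<in> MOU_hom L B \<and>
        (\<forall>k. \<forall>x\<in>carrier (S k). \<nu> (\<iota> k x) = \<beta> k x)"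
      show "\<nu> = restrict \<mu> (carrier L)"
      proof (rule extensionalityI [of _ "carrier L"])
        fix c
        assume c: "c \<in> carrier L"
        \<comment> \<open>Every element of the limit comes from a stage, where the value of
          \<open>\<nu>\<close> is prescribed by \<open>\<beta>\<close>.\<close>
        then obtain k x where "x \<in> carrier (S k)" "c = \<iota> k x" by (rule carrier_L_cases)
        then show "\<nu> c = restrict \<mu> (carrier L) c" using c \<nu> \<mu>(2) by simp
      qed (use \<nu> in auto)
    qed (simp_all add: \<mu>(2))
  qed
qed

end
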